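(* Let $\mathbb{B}$ be a complete Boolean algebra and let $\kappa$ be a weakly compact cardinal. If $\mathbb{B}$ is weakly $(2^\kappa,\kappa)$-distributive and $\mathbb{B}$ is $(\alpha,2)$-distributive for each $\alpha<\kappa$, then $\mathbb{B}$ is $(\kappa,2)$-distributive.
   Context: For ordinals $\mu,\nu$, a complete Boolean algebra $\mathbb{B}$ is $(\mu,\nu)$-distributive iff for every family $\langle u_{\alpha,\beta} \in \mathbb{B} : \alpha<\mu, \beta<\nu\rangle$, $\prod_{\alpha<\mu}\sum_{\beta<\nu} u_{\alpha,\beta} = \sum_{f:\mu\to\nu}\prod_{\alpha<\mu} u_{\alpha,f(\alpha)}$. It is weakly $(\mu,\nu)$-distributive iff for every such family, $\prod_{\alpha<\mu}\sum_{\beta<\nu} u_{\alpha,\beta} = \sum_{g:\mu\to\nu}\prod_{\alpha<\mu}\sum_{\beta<g(\alpha)} u_{\alpha,\beta}$. (Here $\prod$ and $\sum$ are infima and suprema in $\mathbb{B}$.) A cardinal is weakly compact iff it is strongly inaccessible and has the tree property. $2^\kappa$ denotes cardinal exponentiation. *)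

theory Defs
  imports Main
begin

unbundle cardinal_syntax

text \<open>
  Ordinals are well-order relations (up to \<open>=o\<close>), cardinals are relations satisfying
  \<open>Card_order\<close>, and the elements of the ordinal \<open>\<mu>\<close> are the points of \<open>Field \<mu>\<close>.

  Complete Boolean algebras are types of sort \<open>{boolean_algebra, complete_lattice}\<close>. The
  library class \<open>complete_boolean_algebra\<close> is not used: it is based on
  \<open>complete_distrib_lattice\<close>, hence it assumes complete distributivity.
\<close>

definition distributive ::
    "'b::{boolean_algebra, complete_lattice} itself \<Rightarrow> 'm rel \<Rightarrow> 'n rel \<Rightarrow> bool" where
  "distributive B \<mu> \<nu> \<longleftrightarrow>
     (\<forall>u :: 'm \<Rightarrow> 'n \<Rightarrow> 'b.
        (INF \<alpha>\<in>Field \<mu>. SUP \<beta>\<in>Field \<nu>. u \<alpha> \<beta>) =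
        (SUP f\<in>Func (Field \<mu>) (Field \<nu>). INF \<alpha>\<in>Field \<mu>. u \<alpha> (f \<alpha>)))"

definition weakly_distributive ::
    "'b::{boolean_algebra, complete_lattice} itself \<Rightarrow> 'm rel \<Rightarrow> 'n rel \<Rightarrow> bool" where
  "weakly_distributive B \<mu> \<nu> \<longleftrightarrow>
     (\<forall>u :: 'm \<Rightarrow> 'n \<Rightarrow> 'b.
        (INF \<alpha>\<in>Field \<mu>. SUP \<beta>\<in>Field \<nu>. u \<alpha> \<beta>) =
        (SUP g\<in>Func (Field \<mu>) (Field \<nu>).
           INF \<alpha>\<in>Field \<mu>. SUP \<beta>\<in>underS \<nu> (g \<alpha>). u \<alpha> \<beta>))"

text \<open>
  In the next definition, all cardinals below \<open>\<kappa>\<close> are represented on the type of \<open>\<kappa>\<close>.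
\<close>

definition strongly_inaccessible :: "'k rel \<Rightarrow> bool" where
  "strongly_inaccessible \<kappa> \<longleftrightarrow>
     Card_order \<kappa> \<and> natLeq <o \<kappa> \<and> regularCard \<kappa> \<and>
     (\<forall>l :: 'k rel. Card_order l \<and> l <o \<kappa> \<longrightarrow> ctwo ^c l <o \<kappa>)"

text \<open>A tree is given by its reflexive order; its set of nodes is the field of that order.\<close>

definition node_height :: "'t rel \<Rightarrow> 't \<Rightarrow> 't rel" where
  "node_height T t = Restr T (underS T t)"

definition is_tree :: "'t rel \<Rightarrow> bool" where
  "is_tree T \<longleftrightarrow> Partial_order T \<and> (\<forall>t\<in>Field T. Well_order (node_height T t))"

definition level :: "'t rel \<Rightarrow> 'o rel \<Rightarrow> 't set" where
  "level T \<alpha> = {t \<in> Field T. node_height T t =o \<alpha>}"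

text \<open>The height of a tree is the least ordinal \<open>\<alpha>\<close> whose level is empty.\<close>

definition has_height :: "'t rel \<Rightarrow> 'o rel \<Rightarrow> bool" where
  "has_height T \<kappa> \<longleftrightarrow>
     level T \<kappa> = {} \<and> (\<forall>\<alpha> :: 'o rel. \<alpha> <o \<kappa> \<longrightarrow> level T \<alpha> \<noteq> {})"

definition kappa_tree :: "'k rel \<Rightarrow> 't rel \<Rightarrow> bool" where
  "kappa_tree \<kappa> T \<longleftrightarrow>
     is_tree T \<and> has_height T \<kappa> \<and>
     (\<forall>\<alpha> :: 'k rel. \<alpha> <o \<kappa> \<longrightarrow> |level T \<alpha>| <o \<kappa>)"

definition is_branch :: "'t rel \<Rightarrow> 't set \<Rightarrow> bool" where
  "is_branch T C \<longleftrightarrow> C \<in> Chains T \<and> (\<forall>D\<in>Chains T. C \<subseteq> D \<longrightarrow> D = C)"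

text \<open>
  For infinite \<open>\<kappa>\<close>, a \<open>\<kappa>\<close>-tree has at most \<open>\<kappa>\<close> nodes, so up to isomorphism every \<open>\<kappa>\<close>-tree
  lives on the type of \<open>\<kappa>\<close>.
\<close>

definition tree_property :: "'k rel \<Rightarrow> bool" where
  "tree_property \<kappa> \<longleftrightarrow>
     (\<forall>T :: 'k rel. kappa_tree \<kappa> T \<longrightarrow> (\<exists>C. is_branch T C \<and> Restr T C =o \<kappa>))"

definition weakly_compact :: "'k rel \<Rightarrow> bool" where
  "weakly_compact \<kappa> \<longleftrightarrow> strongly_inaccessible \<kappa> \<and> tree_property \<kappa>"

end

theory Submission
  imports Defs
begin

text \<open>
  In forcing language: the algebra adds no bounded subsets of \<open>\<kappa>\<close>, and a new subset of \<open>\<kappa>\<close> is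
  impossible because it differs from every ground model \<open>x : \<kappa> \<rightarrow> 2\<close> before some level. Weak
  distributivity bounds these levels by a ground model function \<open>g\<close>. The initial segments that the
  new subset can still have under this bound form a ground model tree of height \<open>\<kappa>\<close>. For a cofinal
  branch \<open>x\<close> of that tree, the new subset can agree with \<open>x\<close> up to \<open>g x\<close>, which the bound forbids.

  Without generic extensions this reads as follows. By \<open>distributive_ctwo_iff\<close> it suffices to treat
  families \<open>v \<xi>, - v \<xi>\<close>, so a failure is a nonzero element \<open>c\<close>, the complement of the supremum over
  all \<open>2\<^sup>\<kappa>\<close> choices \<open>x\<close> of signs of the infima of the literals \<open>\<plusminus> v \<xi>\<close>. By De Morgan, \<open>c\<close> is the
  infimum over \<open>x\<close> of the suprema over \<open>\<xi> < \<kappa>\<close> of the complemented literals, and weak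
  \<open>(2\<^sup>\<kappa>, \<kappa>)\<close>-distributivity yields \<open>g\<close> and a nonzero \<open>d\<close> that lies, for each \<open>x\<close>, below the
  supremum over \<open>\<xi> < g x\<close> already. The tree consists of the \<open>s : a \<rightarrow> 2\<close>, for \<open>a < \<kappa>\<close>, whose
  conjunction of literals meets \<open>d\<close>. Distributivity below \<open>\<kappa>\<close> gives a node at each level.
  Inaccessibility keeps the levels small, so the tree property gives an \<open>x\<close> all of whose initial
  segments are nodes (\<open>cofinal_branch\<close>), and the segment of length \<open>g x\<close> contradicts the choice
  of \<open>d\<close>.
\<close>

section \<open>Complete Boolean algebras\<close>

lemma compl_SUP:
  fixes f :: "'i \<Rightarrow> 'b::{boolean_algebra, complete_lattice}"
  shows "- (SUP i\<in>I. f i) = (INF i\<in>I. - f i)"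
proof (rule antisym)
  show "- (SUP i\<in>I. f i) \<le> (INF i\<in>I. - f i)"
    by (auto intro!: INF_greatest SUP_upper)
  have "(SUP i\<in>I. f i) \<le> - (INF i\<in>I. - f i)"
    by (rule SUP_least, rule compl_le_swap1, rule INF_lower)
  then show "(INF i\<in>I. - f i) \<le> - (SUP i\<in>I. f i)"
    by (rule compl_le_swap1)
qed

lemma compl_INF:
  fixes f :: "'i \<Rightarrow> 'b::{boolean_algebra, complete_lattice}"
  shows "- (INF i\<in>I. f i) = (SUP i\<in>I. - f i)"
  unfolding compl_eq_compl_iff[symmetric, of "- (INF i\<in>I. f i)"]
  unfolding compl_SUP double_compl ..

text \<open>
  A binary meet preserves arbitrary suprema in every complete Boolean algebra, because complements
  make it a left adjoint.
\<close>

lemma inf_SUP_eq_bot: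
  fixes f :: "'i \<Rightarrow> 'b::{boolean_algebra, complete_lattice}"
  assumes "\<And>i. i \<in> I \<Longrightarrow> inf d (f i) = bot"
  shows "inf d (SUP i\<in>I. f i) = bot"
proof -
  have "(SUP i\<in>I. f i) \<le> - d"
    using assms by (intro SUP_least) (metis inf.commute inf_shunt)
  then show ?thesis by (metis inf.commute inf_shunt)
qed

definition literal :: "'b::boolean_algebra \<Rightarrow> bool \<Rightarrow> 'b" where
  "literal p i = (if i then p else - p)"

text \<open>
  A general family is dominated by the literals of its \<open>True\<close> components: below
  \<open>b = (INF \<alpha>. sup (u \<alpha> True) (u \<alpha> False))\<close>, the complement of \<open>u \<alpha> True\<close> lies below
  \<open>u \<alpha> False\<close>. Hence distributivity for partitions into an element and its complement, where the
  left-hand side is \<open>top\<close>, already gives all of \<open>(\<mu>, 2)\<close>-distributivity.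
\<close>

lemma distributive_ctwo_iff:
  "distributive TYPE('b::{boolean_algebra, complete_lattice}) (\<mu> :: 'm rel) ctwo \<longleftrightarrow>
     (\<forall>v :: 'm \<Rightarrow> 'b. (SUP f\<in>Func (Field \<mu>) UNIV. INF \<alpha>\<in>Field \<mu>. literal (v \<alpha>) (f \<alpha>)) = top)"
  (is "?L \<longleftrightarrow> ?R")
proof
  assume L: ?L
  show ?R
  proof
    fix v :: "'m \<Rightarrow> 'b"
    have "(INF \<alpha>\<in>Field \<mu>. SUP i\<in>(UNIV::bool set). literal (v \<alpha>) i) = top"
      by (simp add: UNIV_bool literal_def sup_commute)
    then show "(SUP f\<in>Func (Field \<mu>) UNIV. INF \<alpha>\<in>Field \<mu>. literal (v \<alpha>) (f \<alpha>)) = top"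
      using L[unfolded distributive_def, rule_format, of "\<lambda>\<alpha>. literal (v \<alpha>)"]
      by (simp add: ctwo_def Field_card_of)
  qed
next
  assume R: ?R
  show ?L
    unfolding distributive_def ctwo_def Field_card_of
  proof (intro allI antisym)
    fix u :: "'m \<Rightarrow> bool \<Rightarrow> 'b"
    let ?b = "INF \<alpha>\<in>Field \<mu>. SUP i\<in>UNIV. u \<alpha> i"
    let ?c = "SUP f\<in>Func (Field \<mu>) UNIV. INF \<alpha>\<in>Field \<mu>. u \<alpha> (f \<alpha>)"
    have split: "?b \<le> sup (u \<alpha> True) (u \<alpha> False)" if "\<alpha> \<in> Field \<mu>" for \<alpha>
      using INF_lower[OF that, of "\<lambda>\<alpha>. SUP i\<in>UNIV. u \<alpha> i"] by (simp add: UNIV_bool sup_commute)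
    have lit: "inf (literal (u \<alpha> True) i) ?b \<le> u \<alpha> i" if "\<alpha> \<in> Field \<mu>" for \<alpha> i
    proof (cases i)
      case False
      have "inf (- u \<alpha> True) ?b \<le> inf (- u \<alpha> True) (sup (u \<alpha> True) (u \<alpha> False))"
        using split[OF that] by (intro inf_mono order_refl)
      also have "\<dots> \<le> u \<alpha> False"
        by (simp add: inf_sup_distrib1)
      finally show ?thesis using False by (simp add: literal_def)
    qed (simp add: literal_def)
    have "(INF \<alpha>\<in>Field \<mu>. literal (u \<alpha> True) (f \<alpha>)) \<le> sup (- ?b) ?c"
      if f: "f \<in> Func (Field \<mu>) UNIV" for f
    proof -
      have "inf (INF \<alpha>\<in>Field \<mu>. literal (u \<alpha> True) (f \<alpha>)) ?b \<le> (INF \<alpha>\<in>Field \<mu>. u \<alpha> (f \<alpha>))"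
        by (intro INF_greatest order_trans[OF _ lit] inf_mono order_refl INF_lower)
      also have "\<dots> \<le> ?c" using f by (rule SUP_upper)
      finally show ?thesis by (simp only: shunt1)
    qed
    then have "(SUP f\<in>Func (Field \<mu>) UNIV. INF \<alpha>\<in>Field \<mu>. literal (u \<alpha> True) (f \<alpha>)) \<le> sup (- ?b) ?c"
      by (rule SUP_least)
    then have "sup (- ?b) ?c = top"
      using R by (simp add: top_unique)
    then have "inf top ?b \<le> ?c"
      by (simp only: shunt1)
    then show "?b \<le> ?c" by simp
    show "?c \<le> ?b"
      by (intro SUP_least INF_greatest) (meson INF_lower SUP_upper UNIV_I order_trans)
  qed
qed

section \<open>Trees of functions on initial segments\<close>

text \<open>
  The tree property speaks of trees on the type of \<open>\<kappa>\<close> itself. A tree on any other type with at most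
  \<open>\<kappa>\<close> nodes is copied there along an injection, which preserves heights of nodes up to isomorphism.
  A chain of size \<open>\<kappa>\<close> is all that is needed of the branch.
\<close>

lemma tree_property_chain:
  fixes \<kappa> :: "'k rel" and T :: "'t rel"
  assumes \<kappa>: "Card_order \<kappa>" and tp: "tree_property \<kappa>"
    and T: "kappa_tree \<kappa> T" and small: "|Field T| \<le>o \<kappa>"
  shows "\<exists>C\<in>Chains T. |C| =o \<kappa>"
proof -
  have "|Field T| \<le>o |Field \<kappa>|"
    using small card_of_mono2[OF small] by (simp add: Field_card_of)
  then have "\<exists>e. inj_on e (Field T) \<and> e ` Field T \<subseteq> Field \<kappa>"
    by (rule iffD2[OF card_of_ordLeq])
  then obtain e :: "'t \<Rightarrow> 'k" where e: "inj_on e (Field T)" by blast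
  define T' where "T' = dir_image T e"
  have tree: "is_tree T" and ht: "has_height T \<kappa>"
    and lev: "\<And>\<alpha> :: 'k rel. \<alpha> <o \<kappa> \<Longrightarrow> |level T \<alpha>| <o \<kappa>"
    using T by (auto simp: kappa_tree_def)
  have FT': "Field T' = e ` Field T"
    by (simp add: T'_def dir_image_Field)
  have T'_iff: "(e s, e t) \<in> T' \<longleftrightarrow> (s, t) \<in> T" if "s \<in> Field T" "t \<in> Field T" for s t
  proof
    assume "(e s, e t) \<in> T'"
    then obtain s' t' where "(s', t') \<in> T" "e s = e s'" "e t = e t'"
      by (auto simp: T'_def dir_image_def)
    moreover from this(1) have "s' \<in> Field T" "t' \<in> Field T"
      by (auto intro: FieldI1 FieldI2)
    ultimately show "(s, t) \<in> T"
      using e that by (metis inj_onD)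
  qed (auto simp: T'_def dir_image_def)
  have uS: "underS T' (e t) = e ` underS T t" if "t \<in> Field T" for t
  proof (intro set_eqI iffI)
    fix y assume y: "y \<in> underS T' (e t)"
    then have "y \<in> Field T'" by (rule underS_Field)
    then obtain s where s: "s \<in> Field T" "y = e s" using FT' by auto
    with y that T'_iff[of s t] show "y \<in> e ` underS T t" by (auto simp: underS_def)
  next
    fix y assume "y \<in> e ` underS T t"
    then obtain s where s: "s \<in> underS T t" "y = e s" by auto
    moreover from s have "s \<in> Field T" by (auto intro: underS_Field)
    ultimately show "y \<in> underS T' (e t)"
      using T'_iff[of s t] that e by (auto simp: underS_def inj_on_def)
  qed
  have nh: "node_height T' (e t) = dir_image (node_height T t) e" if t: "t \<in> Field T" for t
  proof -
    have "(x, y) \<in> node_height T' (e t) \<longleftrightarrow> (x, y) \<in> dir_image (node_height T t) e" for x y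
    proof -
      have *: "s \<in> Field T" if "s \<in> underS T t" for s using that by (rule underS_Field)
      show ?thesis
        unfolding node_height_def uS[OF t] dir_image_def
        using T'_iff * by (auto simp: image_iff) blast+
    qed
    then show ?thesis by auto
  qed
  have wo: "Well_order (node_height T t)" if "t \<in> Field T" for t
    using tree that by (auto simp: is_tree_def)
  have sub: "Field (node_height T t) \<subseteq> Field T" for t
    by (auto simp: node_height_def Field_def)
  have iso: "node_height T t =o node_height T' (e t)" if "t \<in> Field T" for t
    unfolding nh[OF that] using wo[OF that] inj_on_subset[OF e sub] by (rule dir_image_ordIso)
  have level': "level T' \<alpha> = e ` level T \<alpha>" for \<alpha> :: "'k rel"
    unfolding level_def FT' using iso
    by (auto intro: ordIso_transitive dest: ordIso_symmetric)
  have "is_tree T'"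
    unfolding is_tree_def
  proof
    show "Partial_order T'"
      using tree e unfolding T'_def is_tree_def by (blast intro: Partial_order_dir_image)
    show "\<forall>t\<in>Field T'. Well_order (node_height T' t)"
      using iso by (auto simp: FT' ordIso_def)
  qed
  moreover have "has_height T' \<kappa>"
    using ht by (auto simp: has_height_def level')
  moreover have "|level T' \<alpha>| <o \<kappa>" if "\<alpha> <o \<kappa>" for \<alpha> :: "'k rel"
    unfolding level' by (rule ordLeq_ordLess_trans[OF card_of_image lev[OF that]])
  ultimately have "kappa_tree \<kappa> T'"
    by (simp add: kappa_tree_def)
  then obtain C' where C': "C' \<in> Chains T'" "Restr T' C' =o \<kappa>"
    using tp by (auto simp: tree_property_def is_branch_def)
  have "Field (Restr T' C') = C'"
    using C'(1) by (auto simp: Chains_def Field_def)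
  then have cardC': "|C'| =o \<kappa>"
    using card_of_cong[OF C'(2)] card_of_Field_ordIso[OF \<kappa>] ordIso_transitive by metis
  define C where "C = {t \<in> Field T. e t \<in> C'}"
  have "C' \<subseteq> Field T'"
    using C'(1) by (auto simp: Chains_def Field_def)
  then have "C' = e ` C"
    by (auto simp: C_def FT')
  moreover have "inj_on e C"
    using e by (rule inj_on_subset) (auto simp: C_def)
  ultimately have "|C| =o |C'|"
    by (intro card_of_ordIsoI) (auto simp: bij_betw_def)
  then have "|C| =o \<kappa>"
    using cardC' by (rule ordIso_transitive)
  moreover have "C \<in> Chains T"
    using C'(1) T'_iff by (auto simp: Chains_def C_def)
  ultimately show ?thesis by blast
qed

text \<open>
  Distinct points of a well-order have non-isomorphic initial segments. This identifies the level of
  a node with the length of its function.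
\<close>

lemma Restr_underS_ordIso_inj:
  assumes r: "Well_order r" and ab: "a \<in> Field r" "b \<in> Field r"
    and iso: "Restr r (underS r a) =o Restr r (underS r b)"
  shows "a = b"
proof -
  have less: "Restr r (underS r x) <o Restr r (underS r y)"
    if xy: "(x, y) \<in> r" "x \<noteq> y" for x y
  proof -
    have wo: "wo_rel r" and TRANS: "trans r" and ANTISYM: "antisym r"
      using r wo_rel.TRANS wo_rel.ANTISYM by (auto simp: wo_rel_def)
    let ?r = "Restr r (underS r y)"
    have F: "Field ?r = underS r y"
      using r wo_rel.underS_ofilter[OF wo] by (simp add: Field_Restr_ofilter)
    have x: "x \<in> underS r y"
      using xy by (simp add: underS_def)
    have "underS ?r x = underS r x"
      using xy TRANS ANTISYM by (auto simp: underS_def dest: transD antisymD)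
    moreover have "underS r x \<subseteq> underS r y"
      using xy TRANS ANTISYM by (auto simp: underS_def dest: transD antisymD)
    ultimately have "Restr ?r (underS ?r x) = Restr r (underS r x)"
      by auto
    moreover have "Restr ?r (underS ?r x) <o ?r"
      using F x by (intro underS_Restr_ordLess Well_order_Restr r) auto
    ultimately show ?thesis by simp
  qed
  have "(a, b) \<in> r \<or> (b, a) \<in> r"
    using r ab wo_rel.TOTALS[of r] by (auto simp: wo_rel_def)
  then show ?thesis
    using less iso by (metis ordIso_symmetric not_ordLess_ordIso)
qed

text \<open>
  A node carries its length \<open>a\<close> explicitly, since the functions of \<open>Func (underS r a) UNIV\<close> are total
  ones that take the value \<open>undefined\<close> outside \<open>underS r a\<close>, from which \<open>a\<close> cannot be read off.
\<close>

definition segment_nodes :: "'k rel \<Rightarrow> ('k \<Rightarrow> ('k \<Rightarrow> bool) \<Rightarrow> bool) \<Rightarrow> ('k \<times> ('k \<Rightarrow> bool)) set" where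
  "segment_nodes r P = {(a, s). a \<in> Field r \<and> s \<in> Func (underS r a) UNIV \<and> P a s}"

definition segment_tree ::
    "'k rel \<Rightarrow> ('k \<Rightarrow> ('k \<Rightarrow> bool) \<Rightarrow> bool) \<Rightarrow> ('k \<times> ('k \<Rightarrow> bool)) rel" where
  "segment_tree r P =
     {((a, s), (b, t)). (a, s) \<in> segment_nodes r P \<and> (b, t) \<in> segment_nodes r P \<and>
        (a, b) \<in> r \<and> (\<forall>\<xi>\<in>underS r a. s \<xi> = t \<xi>)}"

definition cut :: "'k rel \<Rightarrow> 'k \<Rightarrow> ('k \<Rightarrow> bool) \<Rightarrow> 'k \<Rightarrow> bool" where
  "cut r a s = (\<lambda>\<xi>. if \<xi> \<in> underS r a then s \<xi> else undefined)"

lemma cut_in_Func [simp]: "cut r a s \<in> Func (underS r a) UNIV"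
  by (auto simp: cut_def Func_def)

lemma cut_eq: "\<xi> \<in> underS r a \<Longrightarrow> cut r a s \<xi> = s \<xi>"
  by (simp add: cut_def)

lemma Func_eqI:
  "s \<in> Func A B \<Longrightarrow> t \<in> Func A B \<Longrightarrow> (\<And>\<xi>. \<xi> \<in> A \<Longrightarrow> s \<xi> = t \<xi>) \<Longrightarrow> s = t"
  unfolding Func_def by (intro ext) (metis (mono_tags, lifting) mem_Collect_eq)

text \<open>
  The predicate takes total functions. Heredity with \<open>b = a\<close> says that \<open>P a s\<close> depends on the values
  of \<open>s\<close> below \<open>a\<close> only, and with \<open>b < a\<close> that the nodes are closed under restriction.
\<close>

locale hereditary_segments =
  fixes \<kappa> :: "'k rel" and P :: "'k \<Rightarrow> ('k \<Rightarrow> bool) \<Rightarrow> bool"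
  assumes inacc: "strongly_inaccessible \<kappa>"
    and nonempty: "a \<in> Field \<kappa> \<Longrightarrow> \<exists>s. P a s"
    and hereditary: "\<lbrakk>P a s; (b, a) \<in> \<kappa>; \<forall>\<xi>\<in>underS \<kappa> b. t \<xi> = s \<xi>\<rbrakk> \<Longrightarrow> P b t"
begin

abbreviation "N \<equiv> segment_nodes \<kappa> P"
abbreviation "T \<equiv> segment_tree \<kappa> P"

lemma Card_order: "Card_order \<kappa>"
  using inacc by (simp add: strongly_inaccessible_def)

lemma Well_order: "Well_order \<kappa>"
  using Card_order by (simp add: card_order_on_def)

lemma REFL: "Refl \<kappa>" and TRANS: "trans \<kappa>" and ANTISYM: "antisym \<kappa>"
  and TOTALS: "\<forall>a\<in>Field \<kappa>. \<forall>b\<in>Field \<kappa>. (a, b) \<in> \<kappa> \<or> (b, a) \<in> \<kappa>"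
  using wo_rel.REFL[of \<kappa>] wo_rel.TRANS[of \<kappa>] wo_rel.ANTISYM[of \<kappa>] wo_rel.TOTALS[of \<kappa>]
    Well_order by (simp_all add: wo_rel_def)

lemma infinite_Field: "\<not> finite (Field \<kappa>)"
proof
  assume "finite (Field \<kappa>)"
  moreover have "|Field natLeq| \<le>o |Field \<kappa>|"
    using inacc by (intro card_of_mono2 ordLess_imp_ordLeq) (simp add: strongly_inaccessible_def)
  ultimately have "finite (Field natLeq)"
    by (rule card_of_ordLeq_finite[rotated])
  then show False by (simp add: Field_natLeq)
qed

lemma Field_nonempty: "Field \<kappa> \<noteq> {}"
  using infinite_Field by auto

lemma underS_mono: "(a, b) \<in> \<kappa> \<Longrightarrow> underS \<kappa> a \<subseteq> underS \<kappa> b"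
  using TRANS ANTISYM by (auto simp: underS_def dest: transD antisymD)

lemma Field_T: "Field T = N"
proof
  show "Field T \<subseteq> N"
    by (auto simp: Field_def segment_tree_def)
  show "N \<subseteq> Field T"
  proof
    fix x assume "x \<in> N"
    then have "(x, x) \<in> T"
      using REFL by (auto simp: segment_tree_def segment_nodes_def refl_on_def)
    then show "x \<in> Field T" by (rule FieldI1)
  qed
qed

lemma N_I: "(a, s) \<in> N" if "a \<in> Field \<kappa>" "P a s'" "\<forall>\<xi>\<in>underS \<kappa> a. s \<xi> = s' \<xi>"
  "s \<in> Func (underS \<kappa> a) UNIV"
  using that hereditary[OF that(2), of a s] REFL by (auto simp: segment_nodes_def refl_on_def)

lemma Partial_order_T: "Partial_order T"
proof -
  have "T \<subseteq> Field T \<times> Field T" by (auto simp: Field_def)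
  moreover have "refl_on (Field T) T"
    unfolding Field_T using REFL by (auto simp: refl_on_def segment_tree_def segment_nodes_def)
  moreover have "trans T"
  proof (rule transI)
    fix x y z assume "(x, y) \<in> T" "(y, z) \<in> T"
    then show "(x, z) \<in> T"
      using underS_mono TRANS unfolding segment_tree_def by (fastforce dest: transD)
  qed
  moreover have "antisym T"
  proof (rule antisymI)
    fix x y assume "(x, y) \<in> T" "(y, x) \<in> T"
    then show "x = y"
      using ANTISYM unfolding segment_tree_def segment_nodes_def
      by (auto dest: antisymD intro: Func_eqI)
  qed
  ultimately show ?thesis by (simp add: partial_order_on_def preorder_on_def)
qed

text \<open>
  The predecessors of \<open>(a, s)\<close> are exactly the restrictions of \<open>s\<close> to the \<open>b < a\<close>, so they form a copy
  of the initial segment of \<open>\<kappa>\<close> below \<open>a\<close>.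
\<close>

lemma node_height_ordIso:
  assumes "(a, s) \<in> N"
  shows "Restr \<kappa> (underS \<kappa> a) =o node_height T (a, s)"
proof -
  let ?f = "\<lambda>b. (b, cut \<kappa> b s)"
  have a: "a \<in> Field \<kappa>" "P a s" "s \<in> Func (underS \<kappa> a) UNIV"
    using assms by (auto simp: segment_nodes_def)
  have N: "?f b \<in> N" if "b \<in> underS \<kappa> a" for b
  proof (rule N_I)
    show "P b s" using hereditary[OF a(2), of b s] that by (auto simp: underS_def)
  next
    show "b \<in> Field \<kappa>" using that by (rule underS_Field)
  qed (simp_all add: cut_eq)
  have uS: "underS T (a, s) = ?f ` underS \<kappa> a"
  proof (intro set_eqI iffI)
    fix x assume x: "x \<in> underS T (a, s)"
    obtain b t where bt: "x = (b, t)" by (cases x)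
    have *: "(b, t) \<in> N" "(b, a) \<in> \<kappa>" "\<forall>\<xi>\<in>underS \<kappa> b. t \<xi> = s \<xi>" "(b, t) \<noteq> (a, s)"
      using x bt by (auto simp: underS_def segment_tree_def)
    have t: "t \<in> Func (underS \<kappa> b) UNIV" using * by (simp add: segment_nodes_def)
    have "b \<noteq> a" using * t a(3) Func_eqI by blast
    moreover have "t = cut \<kappa> b s"
      using t cut_in_Func by (rule Func_eqI) (use * in \<open>auto simp: cut_def\<close>)
    ultimately show "x \<in> ?f ` underS \<kappa> a" using * bt by (auto simp: underS_def)
  next
    fix x assume "x \<in> ?f ` underS \<kappa> a"
    then show "x \<in> underS T (a, s)"
      using N assms by (auto simp: underS_def segment_tree_def cut_def)
  qed
  have iff: "(?f b, ?f c) \<in> T \<longleftrightarrow> (b, c) \<in> \<kappa>" if "b \<in> underS \<kappa> a" "c \<in> underS \<kappa> a" for b c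
    using N[OF that(1)] N[OF that(2)] underS_mono by (auto simp: segment_tree_def cut_def)
  have "node_height T (a, s) = dir_image (Restr \<kappa> (underS \<kappa> a)) ?f"
    unfolding node_height_def uS dir_image_def using iff by auto
  moreover have "Restr \<kappa> (underS \<kappa> a) =o dir_image (Restr \<kappa> (underS \<kappa> a)) ?f"
    by (intro dir_image_ordIso Well_order_Restr Well_order) (auto simp: inj_on_def)
  ultimately show ?thesis by simp
qed

lemma card_Func_underS: "|Func (underS \<kappa> a) (UNIV :: bool set)| <o \<kappa>" if "a \<in> Field \<kappa>"
proof -
  have "ctwo ^c |underS \<kappa> a| <o \<kappa>"
    using inacc card_of_underS[OF Card_order that]
    by (simp add: strongly_inaccessible_def card_of_Card_order)
  then show ?thesis by (simp add: cexp_def ctwo_def Field_card_of)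
qed

lemma card_N: "|N| \<le>o \<kappa>"
proof -
  have "N \<subseteq> (SIGMA a : Field \<kappa>. Func (underS \<kappa> a) UNIV)"
    by (auto simp: segment_nodes_def)
  moreover have "|SIGMA a : Field \<kappa>. Func (underS \<kappa> a) (UNIV :: bool set)| \<le>o \<kappa>"
    using infinite_Field Card_order card_of_Field_ordIso[OF Card_order] card_Func_underS
    by (intro card_of_Sigma_ordLeq_infinite_Field) (auto intro: ordLess_imp_ordLeq ordIso_imp_ordLeq)
  ultimately show ?thesis
    using card_of_mono1 ordLeq_transitive by blast
qed

lemma ordLessE:
  assumes "(\<alpha> :: 'k rel) <o \<kappa>"
  obtains a where "a \<in> Field \<kappa>" "\<alpha> =o Restr \<kappa> (underS \<kappa> a)"
  using assms ordLess_iff_ordIso_Restr[OF Well_order, of \<alpha>]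
  by (auto simp: ordLess_def)

text \<open>
  Every ordinal below \<open>\<kappa>\<close> is an initial segment of \<open>\<kappa>\<close> at a unique point \<open>a\<close>, and the level of that
  ordinal consists of functions from \<open>underS \<kappa> a\<close> to \<open>2\<close>. There are fewer than \<open>\<kappa>\<close> of these because \<open>\<kappa>\<close>
  is a strong limit.
\<close>

lemma kappa_tree_T: "kappa_tree \<kappa> T"
proof -
  have "is_tree T"
    using Partial_order_T node_height_ordIso
    by (force simp: is_tree_def Field_T ordIso_def)
  moreover have "has_height T \<kappa>"
    unfolding has_height_def
  proof (intro conjI allI impI)
    have "\<not> node_height T (a, s) =o \<kappa>" if "(a, s) \<in> N" for a s
      using node_height_ordIso[OF that] underS_Restr_ordLess[OF Well_order Field_nonempty, of a]
      by (meson not_ordLess_ordIso ordIso_transitive)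
    then show "level T \<kappa> = {}"
      by (auto simp: level_def Field_T)
    fix \<alpha> :: "'k rel" assume "\<alpha> <o \<kappa>"
    then obtain a where a: "a \<in> Field \<kappa>" "\<alpha> =o Restr \<kappa> (underS \<kappa> a)" by (rule ordLessE)
    obtain s where "P a s" using nonempty a by blast
    then have "(a, cut \<kappa> a s) \<in> N"
      using a by (intro N_I[of a s]) (simp_all add: cut_eq)
    moreover from this have "node_height T (a, cut \<kappa> a s) =o \<alpha>"
      using a(2) node_height_ordIso by (meson ordIso_symmetric ordIso_transitive)
    ultimately show "level T \<alpha> \<noteq> {}"
      by (auto simp: level_def Field_T)
  qed
  moreover have "|level T \<alpha>| <o \<kappa>" if less: "\<alpha> <o \<kappa>" for \<alpha> :: "'k rel"
  proof -
    obtain a where a: "a \<in> Field \<kappa>" "\<alpha> =o Restr \<kappa> (underS \<kappa> a)" using less by (rule ordLessE)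
    have "level T \<alpha> \<subseteq> Pair a ` Func (underS \<kappa> a) UNIV"
    proof
      fix x assume x: "x \<in> level T \<alpha>"
      obtain b t where bt: "x = (b, t)" by (cases x)
      have N: "(b, t) \<in> N" and "node_height T (b, t) =o \<alpha>"
        using x bt by (auto simp: level_def Field_T)
      then have "Restr \<kappa> (underS \<kappa> b) =o Restr \<kappa> (underS \<kappa> a)"
        using a(2) node_height_ordIso[OF N] by (meson ordIso_transitive)
      then have "b = a"
        using N a(1) by (intro Restr_underS_ordIso_inj[OF Well_order]) (auto simp: segment_nodes_def)
      then show "x \<in> Pair a ` Func (underS \<kappa> a) UNIV"
        using N bt by (auto simp: segment_nodes_def)
    qed
    then have "|level T \<alpha>| \<le>o |Func (underS \<kappa> a) (UNIV :: bool set)|"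
      by (rule ordLeq_transitive[OF card_of_mono1 card_of_image])
    then show ?thesis
      using card_Func_underS[OF a(1)] by (rule ordLeq_ordLess_trans)
  qed
  ultimately show ?thesis by (simp add: kappa_tree_def)
qed

text \<open>
  A chain contains at most one node of each length, so a chain of size \<open>\<kappa>\<close> has nodes of unbounded
  length: otherwise it would inject into a proper initial segment of the cardinal \<open>\<kappa>\<close>.
  The union of its functions is then defined on all of \<open>\<kappa>\<close>.
\<close>

lemma cofinal_branch:
  assumes "tree_property \<kappa>"
  shows "\<exists>x\<in>Func (Field \<kappa>) UNIV. \<forall>a\<in>Field \<kappa>. P a x"
proof -
  obtain C where C: "C \<in> Chains T" "|C| =o \<kappa>"
    using tree_property_chain[OF Card_order assms kappa_tree_T] card_N by (auto simp: Field_T)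
  have CN: "C \<subseteq> N"
    using C(1) by (auto simp: Chains_def segment_tree_def)
  have comp: "(\<forall>\<xi>\<in>underS \<kappa> a \<inter> underS \<kappa> b. s \<xi> = t \<xi>)" if "(a, s) \<in> C" "(b, t) \<in> C" for a s b t
  proof -
    have "((a, s), (b, t)) \<in> T \<or> ((b, t), (a, s)) \<in> T"
      using C(1) that by (auto simp: Chains_def)
    then show ?thesis by (auto simp: segment_tree_def)
  qed
  have inj: "inj_on fst C"
  proof (rule inj_onI)
    fix x y assume xy: "x \<in> C" "y \<in> C" "fst x = fst y"
    then obtain a s t where st: "x = (a, s)" "y = (a, t)" by (metis prod.collapse)
    with xy have "s \<in> Func (underS \<kappa> a) UNIV" "t \<in> Func (underS \<kappa> a) UNIV"
      using CN by (auto simp: segment_nodes_def)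
    then have "s = t"
      using comp[of a s a t] xy st by (intro Func_eqI[of s _ UNIV t]) auto
    with st show "x = y" by simp
  qed
  have cofinal: "\<exists>(b, t)\<in>C. (a, b) \<in> \<kappa>" if a: "a \<in> Field \<kappa>" for a
  proof (rule ccontr)
    assume neg: "\<not> ?thesis"
    have "fst x \<in> underS \<kappa> a" if "x \<in> C" for x
    proof -
      have "fst x \<in> Field \<kappa>" using that CN by (auto simp: segment_nodes_def)
      moreover have "(a, fst x) \<notin> \<kappa>" using that neg by auto
      moreover have "(a, a) \<in> \<kappa>" using a REFL by (simp add: refl_on_def)
      ultimately show ?thesis using a TOTALS by (auto simp: underS_def)
    qed
    with inj have "|C| \<le>o |underS \<kappa> a|" by (rule card_of_ordLeqI)
    then have "|C| <o \<kappa>"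
      using card_of_underS[OF Card_order a] by (rule ordLeq_ordLess_trans)
    with C(2) show False by (simp add: not_ordLess_ordIso)
  qed
  \<comment> \<open>The union of the functions in \<open>C\<close>, read as the set of points where one of them is true.\<close>
  define x where "x = (\<lambda>\<xi>. if \<xi> \<in> Field \<kappa> then \<exists>(b, t)\<in>C. \<xi> \<in> underS \<kappa> b \<and> t \<xi> else undefined)"
  have "P a x" if a: "a \<in> Field \<kappa>" for a
  proof -
    obtain b t where bt: "(b, t) \<in> C" "(a, b) \<in> \<kappa>" using cofinal[OF a] by auto
    have "x \<xi> = t \<xi>" if "\<xi> \<in> underS \<kappa> a" for \<xi>
    proof -
      have "\<xi> \<in> underS \<kappa> b" using that underS_mono[OF bt(2)] by auto
      then have "(\<exists>(b', t')\<in>C. \<xi> \<in> underS \<kappa> b' \<and> t' \<xi>) \<longleftrightarrow> t \<xi>"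
        using bt(1) comp[OF bt(1)] by blast
      then show ?thesis
        using underS_Field[OF that] by (simp add: x_def)
    qed
    then show "P a x"
      using hereditary[of b t a x] bt CN by (auto simp: segment_nodes_def)
  qed
  moreover have "x \<in> Func (Field \<kappa>) UNIV"
    by (auto simp: x_def Func_def)
  ultimately show ?thesis by blast
qed

end

section \<open>Weak distributivity and weakly compact cardinals\<close>

theorem mainTheorem2:
  fixes \<kappa> :: "'k rel"
  assumes "weakly_compact \<kappa>"
    and "weakly_distributive TYPE('b::{boolean_algebra, complete_lattice}) (ctwo ^c \<kappa>) \<kappa>"
    and "\<And>\<alpha> :: 'k rel. \<alpha> <o \<kappa> \<Longrightarrow> distributive TYPE('b) \<alpha> ctwo"
  shows "distributive TYPE('b) \<kappa> ctwo"
  unfolding distributive_ctwo_iff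
proof
  fix v :: "'k \<Rightarrow> 'b"
  let ?F = "Func (Field \<kappa>) (UNIV :: bool set)"
  have inacc: "strongly_inaccessible \<kappa>" and tp: "tree_property \<kappa>"
    using assms(1) by (auto simp: weakly_compact_def)
  have \<kappa>: "Card_order \<kappa>"
    using inacc by (simp add: strongly_inaccessible_def)
  define c where "c = - (SUP x\<in>?F. INF \<xi>\<in>Field \<kappa>. literal (v \<xi>) (x \<xi>))"
  have "c = (INF x\<in>?F. SUP \<xi>\<in>Field \<kappa>. - literal (v \<xi>) (x \<xi>))"
    by (simp add: c_def compl_SUP compl_INF)
  also have "\<dots> = (SUP g\<in>Func ?F (Field \<kappa>). INF x\<in>?F. SUP \<xi>\<in>underS \<kappa> (g x). - literal (v \<xi>) (x \<xi>))"
    using assms(2)[unfolded weakly_distributive_def, rule_format, of "\<lambda>x \<xi>. - literal (v \<xi>) (x \<xi>)"]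
    by (simp add: cexp_def ctwo_def Field_card_of)
  also have "\<dots> = bot"
    unfolding SUP_bot_conv
  proof (intro ballI, rule ccontr)
    fix g assume g: "g \<in> Func ?F (Field \<kappa>)"
    define d where "d = (INF x\<in>?F. SUP \<xi>\<in>underS \<kappa> (g x). - literal (v \<xi>) (x \<xi>))"
    assume "(INF x\<in>?F. SUP \<xi>\<in>underS \<kappa> (g x). - literal (v \<xi>) (x \<xi>)) \<noteq> bot"
    then have d: "d \<noteq> bot" by (simp only: d_def not_False_eq_True)
    \<comment> \<open>\<open>m a s\<close> is the Boolean value of the statement that the generic subset agrees with \<open>s\<close> below \<open>a\<close>.\<close>
    define m where "m a s = (INF \<xi>\<in>underS \<kappa> a. literal (v \<xi>) (s \<xi>))" for a s
    define P where "P a s \<longleftrightarrow> inf d (m a s) \<noteq> bot" for a s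
    have "hereditary_segments \<kappa> P"
    proof
      fix a assume a: "a \<in> Field \<kappa>"
      have "(SUP s\<in>Func (underS \<kappa> a) UNIV. m a s) = top"
        using assms(3)[OF card_of_underS[OF \<kappa> a]]
        by (simp add: distributive_ctwo_iff Field_card_of m_def)
      then show "\<exists>s. P a s"
        using inf_SUP_eq_bot[of "Func (underS \<kappa> a) UNIV" d "m a"] d by (auto simp: P_def)
    next
      fix a s b t
      assume "P a s" and ba: "(b, a) \<in> \<kappa>" and eq: "\<forall>\<xi>\<in>underS \<kappa> b. t \<xi> = s \<xi>"
      have "underS \<kappa> b \<subseteq> underS \<kappa> a"
        using ba \<kappa> unfolding card_order_on_def order_on_defs underS_def
        by (auto dest: transD antisymD)
      then have "m a s \<le> m b t"
        using eq by (auto simp: m_def intro!: INF_greatest INF_lower)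
      then have "inf d (m a s) \<le> inf d (m b t)"
        by (intro inf_mono order_refl)
      with \<open>P a s\<close> show "P b t" unfolding P_def by (metis bot_unique)
    qed (rule inacc)
    from hereditary_segments.cofinal_branch[OF this tp] obtain x
      where x: "x \<in> ?F" and branch: "\<And>a. a \<in> Field \<kappa> \<Longrightarrow> P a x" by blast
    \<comment> \<open>At its own bound \<open>g x\<close> the branch \<open>x\<close> is disjoint from \<open>d\<close>, although \<open>P (g x) x\<close> holds.\<close>
    have "d \<le> (SUP \<xi>\<in>underS \<kappa> (g x). - literal (v \<xi>) (x \<xi>))"
      unfolding d_def using x by (rule INF_lower)
    also have "\<dots> = - m (g x) x"
      by (simp add: m_def compl_INF)
    finally have "inf d (m (g x) x) = bot"
      by (rule iffD2[OF inf_shunt])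
    moreover have "g x \<in> Field \<kappa>"
      using g x by (auto simp: Func_def)
    ultimately show False
      using branch by (simp add: P_def)
  qed
  finally show "(SUP x\<in>?F. INF \<xi>\<in>Field \<kappa>. literal (v \<xi>) (x \<xi>)) = top"
    by (metis c_def double_compl compl_bot_eq)
qed

end
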